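(* Let $\Omega=\{z=(z_1,z_2,z_3)\in\mathbb{C}^3 \mid \operatorname{Re} z_3+|z_1^2-z_2^3|^2<0\}$. The $3^{rd}$ order Kobayashi pseudometric of $\Omega$ satisfies $$K^3_\Omega\big((0,0,-1),(0,1,0)\big)\le \left(\frac{8\pi}{1-e^{-2\pi}}\right)^{-1/3}\ (\approx 0.3412).$$
   Context: $\mathbb{D}=\{\zeta\in\mathbb{C} \mid |\zeta|<1\}$. For a domain $\Omega\subset\mathbb{C}^n$, $p\in\Omega$, $v\in\mathbb{C}^n$ and an integer $k\ge 1$, the $k^{th}$ order Kobayashi pseudometric (Yu) is $$K^k_\Omega(p,v)=\inf\Big\{\tfrac1r>0 \ \Big|\ \exists f:\mathbb{D}\to\Omega \text{ holomorphic},\ f(0)=p,\ \nu(f)\ge k,\ f^{(k)}(0)=k!\,r\,v\Big\},$$ where $r>0$ and $\nu(f)\ge k$ means $f^{(\ell)}(0)=0$ for all $1\le \ell\le k-1$ (that is, $f-f(0)$ vanishes to order at least $k$ at $0$). *)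

theory Defs
  imports "HOL-Complex_Analysis.Complex_Analysis"
begin

definition holomorphic_map_on :: "(complex \<Rightarrow> complex ^ 'n) \<Rightarrow> complex set \<Rightarrow> bool"
  where "holomorphic_map_on f S \<longleftrightarrow> (\<forall>i. (\<lambda>\<zeta>. f \<zeta> $ i) holomorphic_on S)"

definition higher_deriv_map :: "nat \<Rightarrow> (complex \<Rightarrow> complex ^ 'n) \<Rightarrow> complex \<Rightarrow> complex ^ 'n"
  where "higher_deriv_map l f \<zeta> = (\<chi> i. (deriv ^^ l) (\<lambda>w. f w $ i) \<zeta>)"

definition vanishing_order_ge :: "nat \<Rightarrow> (complex \<Rightarrow> complex ^ 'n) \<Rightarrow> bool"
  where "vanishing_order_ge k f \<longleftrightarrow> (\<forall>l. 1 \<le> l \<and> l < k \<longrightarrow> higher_deriv_map l f 0 = 0)"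

text \<open>
  The infimum is taken in the reals. It is meaningful for \<open>\<Omega>\<close> open, \<open>p \<in> \<Omega>\<close> and \<open>k \<ge> 1\<close>:
  the set is then bounded below by 0, and it is nonempty since the disc
  \<open>\<zeta> \<mapsto> p + r \<zeta>^k v\<close> is admissible for small \<open>r > 0\<close>.
\<close>

definition kobayashi_yu :: "nat \<Rightarrow> (complex ^ 'n) set \<Rightarrow> complex ^ 'n \<Rightarrow> complex ^ 'n \<Rightarrow> real"
  where "kobayashi_yu k \<Omega> p v =
    Inf {1 / r | r :: real. r > 0 \<and>
      (\<exists>f. holomorphic_map_on f (ball 0 1) \<and> f ` ball 0 1 \<subseteq> \<Omega> \<and> f 0 = p \<and>
           vanishing_order_ge k f \<and>
           higher_deriv_map k f 0 = (fact k * complex_of_real r) *s v)}"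

end

theory Submission imports Defs
begin

text \<open>
  With \<open>M = (1 + \<zeta>) / (1 - \<zeta>)\<close> put \<open>P = 2 M\<^sup>4 - 1\<close>. Then
  \<open>P\<^sup>2 - 1 = 4 M\<^sup>4 (M\<^sup>4 - 1) = 32 \<zeta> (1 + \<zeta>\<^sup>2) (1 + \<zeta>)\<^sup>4 / (1 - \<zeta>)\<^sup>8\<close>, which on the unit disc vanishes
  only at 0 and there to first order, since \<open>M\<close> maps the disc to the right half plane. Hence
  \<open>P\<^sup>2 - \<zeta> k\<^sup>3 = 1\<close> for a holomorphic \<open>k\<close> with \<open>k(0)\<^sup>3 = 32\<close>, and the disc
  \<open>\<zeta> \<mapsto> (\<zeta>\<^sup>4 P, \<zeta>\<^sup>3 k, -1)\<close> lies in \<open>\<Omega>\<close> because \<open>(\<zeta>\<^sup>4 P)\<^sup>2 - (\<zeta>\<^sup>3 k)\<^sup>3 = \<zeta>\<^sup>8\<close>. It gives the bound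
  \<open>32 powr (-1/3)\<close>, which is smaller than the one claimed.
\<close>

text \<open>By the Leibniz rule: the derivatives of \<open>w ^ n\<close> of order below
  \<open>n\<close> vanish at 0, so only the term with \<open>i = l = n\<close> can survive.\<close>

lemma higher_deriv_power_mult_at_0:
  assumes "u holomorphic_on S" "open S" "0 \<in> S" "l \<le> n"
  shows "(deriv ^^ l) (\<lambda>w. w ^ n * u w) 0 = (if l = n then fact n * u 0 else 0)"
proof -
  have pow: "(deriv ^^ i) (\<lambda>w::complex. w ^ n) 0 = (if i = n then fact n else 0)" if "i \<le> n" for i
    using that higher_deriv_power[of i 0 n 0] by (auto simp: pochhammer_fact)
  have "(deriv ^^ l) (\<lambda>w. w ^ n * u w) 0 =
      (\<Sum>i=0..l. of_nat (l choose i) * (deriv ^^ i) (\<lambda>w. w ^ n) 0 * (deriv ^^ (l - i)) u 0)"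
    using assms by (intro higher_deriv_mult) (auto intro!: holomorphic_intros)
  also have "\<dots> = (\<Sum>i=0..l. if i = n then fact n * u 0 else 0)"
    using assms(4) by (intro sum.cong refl) (auto simp: pow)
  also have "\<dots> = (if l = n then fact n * u 0 else 0)"
    using assms(4) by simp
  finally show ?thesis .
qed

lemma kobayashi_yu_le:
  fixes f :: "complex \<Rightarrow> complex ^ 'n"
  assumes "r > 0" "holomorphic_map_on f (ball 0 1)" "f ` ball 0 1 \<subseteq> \<Omega>" "f 0 = p"
    and "vanishing_order_ge k f" "higher_deriv_map k f 0 = (fact k * complex_of_real r) *s v"
  shows "kobayashi_yu k \<Omega> p v \<le> 1 / r"
  unfolding kobayashi_yu_def
proof (rule cInf_lower)
  show "bdd_below {1 / r | r :: real. r > 0 \<and>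
      (\<exists>f. holomorphic_map_on f (ball 0 1) \<and> f ` ball 0 1 \<subseteq> \<Omega> \<and> f 0 = p \<and>
           vanishing_order_ge k f \<and>
           higher_deriv_map k f 0 = (fact k * complex_of_real r) *s v)}"
    by (rule bdd_belowI[of _ 0]) auto
qed (use assms in blast)

lemma Re_pos_near_1:
  fixes w :: complex
  assumes "norm w < 1"
  shows "Re (1 + w) > 0" "Re (1 - w) > 0"
  using assms abs_Re_le_cmod[of w] by auto

text \<open>Only the cube of \<open>K\<close> enters, so the algebra is independent of the branch of
  the cube root.\<close>

lemma square_minus_cube_identity:
  fixes \<zeta> K :: complex
  assumes "\<zeta> \<noteq> 1" and "K ^ 3 = 32 * ((1 + \<zeta>\<^sup>2) * (1 + \<zeta>) ^ 4 / (1 - \<zeta>) ^ 8)"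
  shows "(2 * ((1 + \<zeta>) / (1 - \<zeta>)) ^ 4 - 1)\<^sup>2 - \<zeta> * K ^ 3 = 1"
proof -
  have "1 - \<zeta> \<noteq> 0"
    using assms(1) by simp
  then have "(2 * ((1 + \<zeta>) / (1 - \<zeta>)) ^ 4 - 1)\<^sup>2 - 1
      = 4 * (1 + \<zeta>) ^ 4 * ((1 + \<zeta>) ^ 4 - (1 - \<zeta>) ^ 4) / (1 - \<zeta>) ^ 8"
    by (simp add: power_divide divide_simps) algebra
  also have "(1 + \<zeta>) ^ 4 - (1 - \<zeta>) ^ 4 = 8 * \<zeta> * (1 + \<zeta>\<^sup>2)"
    by algebra
  finally show ?thesis
    by (simp add: assms(2) algebra_simps)
qed

lemma holomorphic_solution:
  obtains h k :: "complex \<Rightarrow> complex"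
  where "h holomorphic_on ball 0 1" "k holomorphic_on ball 0 1"
    and "\<And>\<zeta>. norm \<zeta> < 1 \<Longrightarrow> (h \<zeta>)\<^sup>2 - \<zeta> * k \<zeta> ^ 3 = 1"
    and "k 0 = complex_of_real (32 powr (1/3))"
proof
  define h where "h \<zeta> = 2 * ((1 + \<zeta>) / (1 - \<zeta>)) ^ 4 - 1" for \<zeta> :: complex
  \<comment> \<open>A holomorphic branch of the cube root: \<open>1 + \<zeta>\<^sup>2\<close>,
    \<open>1 + \<zeta>\<close> and \<open>1 - \<zeta>\<close> have positive real part on the disc,
    so the principal logarithms are holomorphic there. They vanish at 0, which leaves the real
    factor as \<open>k 0\<close>.\<close>
  define k where "k \<zeta> = complex_of_real (32 powr (1/3)) *
      exp ((Ln (1 + \<zeta>\<^sup>2) + 4 * Ln (1 + \<zeta>) - 8 * Ln (1 - \<zeta>)) / 3)" for \<zeta>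
  have pos: "Re (1 + \<zeta>) > 0" "Re (1 - \<zeta>) > 0" "Re (1 + \<zeta>\<^sup>2) > 0" if "norm \<zeta> < 1" for \<zeta> :: complex
    using Re_pos_near_1[of \<zeta>] Re_pos_near_1[of "\<zeta>\<^sup>2"] that
    by (simp_all add: norm_power power_less_one_iff)
  have nz: "1 + \<zeta> \<noteq> 0" "1 - \<zeta> \<noteq> 0" "1 + \<zeta>\<^sup>2 \<noteq> 0" if "norm \<zeta> < 1" for \<zeta> :: complex
    using pos[OF that] by (metis less_irrefl zero_complex.sel(1))+
  have nonpos: "w \<notin> \<real>\<^sub>\<le>\<^sub>0" if "Re w > 0" for w :: complex
    using that by (auto simp: complex_nonpos_Reals_iff)
  show "h holomorphic_on ball 0 1"
    unfolding h_def using nz by (intro holomorphic_intros) auto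
  show "k holomorphic_on ball 0 1"
    unfolding k_def using nonpos pos by (intro holomorphic_intros) (auto simp: mem_ball_0)
  show "k 0 = complex_of_real (32 powr (1/3))"
    by (simp add: k_def)
  show "(h \<zeta>)\<^sup>2 - \<zeta> * k \<zeta> ^ 3 = 1" if "norm \<zeta> < 1" for \<zeta>
  proof -
    have "(32 powr (1/3)) ^ 3 = (32::real)"
      by (simp add: powr_powr flip: powr_numeral)
    then have r: "complex_of_real (32 powr (1/3)) ^ 3 = 32"
      by (metis of_real_numeral of_real_power)
    have exp_third: "exp (z / 3) ^ 3 = exp z" for z :: complex
      using exp_of_nat_mult[of 3 "z / 3"] by simp
    have "k \<zeta> ^ 3 = 32 * exp (Ln (1 + \<zeta>\<^sup>2) + 4 * Ln (1 + \<zeta>) - 8 * Ln (1 - \<zeta>))"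
      by (simp add: k_def power_mult_distrib r exp_third)
    also have "\<dots> = 32 * ((1 + \<zeta>\<^sup>2) * (1 + \<zeta>) ^ 4 / (1 - \<zeta>) ^ 8)"
      using nz[OF that] exp_of_nat_mult[of 4 "Ln (1 + \<zeta>)"] exp_of_nat_mult[of 8 "Ln (1 - \<zeta>)"]
      by (simp add: exp_add exp_diff)
    finally show ?thesis
      unfolding h_def using nz[OF that] by (intro square_minus_cube_identity) auto
  qed
qed

text \<open>A crude estimate suffices: \<open>exp (- 2 * pi) \<le> 1 / 5\<close> reduces the claim
  to \<open>pi \<le> 3.2\<close>.\<close>

lemma eight_pi_bound: "8 * pi / (1 - exp (- 2 * pi)) \<le> 32"
proof -
  have "1 + 2 * pi \<le> exp (2 * pi)"
    by (rule exp_ge_add_one_self)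
  then have "5 \<le> exp (2 * pi)"
    using pi_gt3 by linarith
  then have "exp (- 2 * pi) \<le> 1 / 5"
    by (simp add: exp_minus field_simps)
  then show ?thesis
    using pi_approx(2) by (simp add: divide_simps)
qed

theorem theorem2p3:
  fixes \<Omega> :: "(complex ^ 3) set"
  defines "\<Omega> \<equiv> {z. Re (z $ 3) + (cmod ((z $ 1) ^ 2 - (z $ 2) ^ 3)) ^ 2 < 0}"
  shows "kobayashi_yu 3 \<Omega> (vector [0, 0, -1]) (vector [0, 1, 0])
    \<le> (8 * pi / (1 - exp (- 2 * pi))) powr (- 1 / 3)"
proof -
  obtain h k :: "complex \<Rightarrow> complex"
    where hol: "h holomorphic_on ball 0 1" "k holomorphic_on ball 0 1"
      and eq: "\<And>\<zeta>. norm \<zeta> < 1 \<Longrightarrow> (h \<zeta>)\<^sup>2 - \<zeta> * k \<zeta> ^ 3 = 1"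
      and k0: "k 0 = complex_of_real (32 powr (1/3))"
    by (rule holomorphic_solution) blast
  \<comment> \<open>The first component is split as \<zeta>^3 times a cofactor vanishing at 0, so
    that its third derivative at 0 vanishes too.\<close>
  define f :: "complex \<Rightarrow> complex ^ 3"
    where "f \<zeta> = vector [\<zeta> ^ 3 * (\<zeta> * h \<zeta>), \<zeta> ^ 3 * k \<zeta>, -1]" for \<zeta>
  have f_hol: "holomorphic_map_on f (ball 0 1)"
    unfolding holomorphic_map_on_def f_def forall_3 vector_3
    using hol by (auto intro!: holomorphic_intros)
  have f_in: "f ` ball 0 1 \<subseteq> \<Omega>"
  proof clarify
    fix \<zeta> :: complex
    assume "\<zeta> \<in> ball 0 1"
    then have \<zeta>: "norm \<zeta> < 1"
      by simp
    \<comment> \<open>The last factor is 1, so membership in \<Omega> becomes -1 + |\<zeta>|^16 <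
      0.\<close>
    have "(\<zeta> ^ 3 * (\<zeta> * h \<zeta>))\<^sup>2 - (\<zeta> ^ 3 * k \<zeta>) ^ 3 = \<zeta> ^ 8 * ((h \<zeta>)\<^sup>2 - \<zeta> * k \<zeta> ^ 3)"
      by algebra
    moreover have "(norm \<zeta> ^ 8)\<^sup>2 < 1"
      using \<zeta> by (simp add: power_less_one_iff)
    ultimately show "f \<zeta> \<in> \<Omega>"
      using eq[OF \<zeta>] by (simp add: \<Omega>_def f_def norm_power)
  qed
  \<comment> \<open>Order 0 is excluded because the third component is the nonzero constant
    -1.\<close>
  have f_deriv: "higher_deriv_map l f 0 = (if l = 3 then vector [0, 6 * k 0, 0] else 0)"
    if "1 \<le> l" "l \<le> 3" for l
  proof -
    have "(\<lambda>\<zeta>. \<zeta> * h \<zeta>) holomorphic_on ball 0 1"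
      using hol by (intro holomorphic_intros)
    from higher_deriv_power_mult_at_0[OF this _ _ that(2)]
    have "(deriv ^^ l) (\<lambda>\<zeta>. \<zeta> ^ 3 * (\<zeta> * h \<zeta>)) 0 = 0"
      by simp
    moreover have "(deriv ^^ l) (\<lambda>\<zeta>. \<zeta> ^ 3 * k \<zeta>) 0 = (if l = 3 then 6 * k 0 else 0)"
      using higher_deriv_power_mult_at_0[OF hol(2) _ _ that(2)] by (simp add: fact_numeral)
    moreover have "(deriv ^^ l) (\<lambda>\<zeta>. -1) (0::complex) = (0::complex)"
      using that(1) by simp
    ultimately show ?thesis
      unfolding vec_eq_iff forall_3 higher_deriv_map_def f_def by simp
  qed
  have "kobayashi_yu 3 \<Omega> (vector [0, 0, -1]) (vector [0, 1, 0]) \<le> 1 / (32 powr (1/3))"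
  proof (rule kobayashi_yu_le)
    show "f 0 = vector [0, 0, -1]"
      by (simp add: f_def)
    show "vanishing_order_ge 3 f"
      unfolding vanishing_order_ge_def by (simp add: f_deriv)
    show "higher_deriv_map 3 f 0 = (fact 3 * complex_of_real (32 powr (1/3))) *s vector [0, 1, 0]"
      by (simp add: f_deriv k0 vec_eq_iff forall_3 fact_numeral)
  qed (use f_hol f_in in simp_all)
  also have "\<dots> = 32 powr (- 1 / 3)"
    by (simp add: powr_minus_divide)
  \<comment> \<open>The exponent is negative, so the larger base 32 gives the smaller power.\<close>
  also have "\<dots> \<le> (8 * pi / (1 - exp (- 2 * pi))) powr (- 1 / 3)"
    by (rule powr_mono2') (use eight_pi_bound in auto)
  finally show ?thesis .
qed

end
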